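(* Let $\mathbf K$ be a field, let $n\ge1$ and $\bar I_n=\{1,2,\dots,n\}$, and let $f:\bar I_n\times\bar I_n\to\bar I_n$ be an $E$-function, i.e. a function satisfying $$f(i,j)=f(j,i),\qquad f(i,f(j,k))=f(f(i,j),k)\qquad\text{for all } i,j,k\in\bar I_n .$$ Then $W^{ij}_k=\delta^{f(i,j)}_k$, $1\le i,j,k\le n$ (where $\delta$ is the Kronecker delta), is a universal extension tensor over $\mathbf K$.
   Context: A family $W=(W^{ij}_s)_{1\le i,j,s\le n}$ of elements of $\mathbf K$ is called a universal extension tensor if, for every Lie algebra $\mathcal G$ over $\mathbf K$, the formula $$([\mathbf x,\mathbf y]_W)_s=\sum_{i,j=1}^n W^{ij}_s[x_i,y_j],\qquad 1\le s\le n,$$ defines a Lie bracket on the vector space $\mathcal G^n$ of $n$-tuples $\mathbf x=(x_1,\dots,x_n)$, $x_i\in\mathcal G$. An $E$-function encodes a finite commutative monoid (no unit element required) $\{e^1,\dots,e^n\}$ with operation $e^i*e^j=e^{f(i,j)}$. *)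

theory Defs
  imports "HOL-Algebra.Module"
begin

text \<open>
  A Lie bracket is required to be alternating, which in characteristic 2 is stronger
  than skew-symmetric.  The bracket is a separate parameter; the \<open>mult\<close> and \<open>one\<close>
  fields that the record type \<open>module\<close> inherits from rings play no role in
  the locale \<open>module\<close> and are ignored.
\<close>

locale lie_algebra = field K + module K V
  for K (structure) and V (structure) +
  fixes bracket :: "'c \<Rightarrow> 'c \<Rightarrow> 'c"
  assumes bracket_closed:
      "\<lbrakk> x \<in> carrier V; y \<in> carrier V \<rbrakk> \<Longrightarrow> bracket x y \<in> carrier V"
    and bracket_add_left:
      "\<lbrakk> x \<in> carrier V; y \<in> carrier V; z \<in> carrier V \<rbrakk>
        \<Longrightarrow> bracket (x \<oplus>\<^bsub>V\<^esub> y) z = bracket x z \<oplus>\<^bsub>V\<^esub> bracket y z"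
    and bracket_add_right:
      "\<lbrakk> x \<in> carrier V; y \<in> carrier V; z \<in> carrier V \<rbrakk>
        \<Longrightarrow> bracket x (y \<oplus>\<^bsub>V\<^esub> z) = bracket x y \<oplus>\<^bsub>V\<^esub> bracket x z"
    and bracket_smult_left:
      "\<lbrakk> a \<in> carrier K; x \<in> carrier V; y \<in> carrier V \<rbrakk>
        \<Longrightarrow> bracket (a \<odot>\<^bsub>V\<^esub> x) y = a \<odot>\<^bsub>V\<^esub> bracket x y"
    and bracket_smult_right:
      "\<lbrakk> a \<in> carrier K; x \<in> carrier V; y \<in> carrier V \<rbrakk>
        \<Longrightarrow> bracket x (a \<odot>\<^bsub>V\<^esub> y) = a \<odot>\<^bsub>V\<^esub> bracket x y"
    and bracket_self:
      "x \<in> carrier V \<Longrightarrow> bracket x x = \<zero>\<^bsub>V\<^esub>"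
    and bracket_jacobi:
      "\<lbrakk> x \<in> carrier V; y \<in> carrier V; z \<in> carrier V \<rbrakk>
        \<Longrightarrow> bracket x (bracket y z) \<oplus>\<^bsub>V\<^esub> bracket y (bracket z x) \<oplus>\<^bsub>V\<^esub> bracket z (bracket x y)
            = \<zero>\<^bsub>V\<^esub>"

text \<open>
  Tuples are extensional functions on \<open>{1..n}\<close>.  The \<open>mult\<close> and \<open>one\<close> fields are irrelevant.
\<close>

definition tuple_space :: "nat \<Rightarrow> ('k, 'g) module \<Rightarrow> ('k, nat \<Rightarrow> 'g) module" where
  "tuple_space n G =
    \<lparr> carrier = {1..n} \<rightarrow>\<^sub>E carrier G,
      mult = undefined,
      one = undefined,
      zero = (\<lambda>s\<in>{1..n}. \<zero>\<^bsub>G\<^esub>),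
      add = (\<lambda>x y. \<lambda>s\<in>{1..n}. x s \<oplus>\<^bsub>G\<^esub> y s),
      smult = (\<lambda>a x. \<lambda>s\<in>{1..n}. a \<odot>\<^bsub>G\<^esub> x s) \<rparr>"

text \<open>The coefficient written \<open>W\<close> with upper indices \<open>i\<close>, \<open>j\<close> and lower index \<open>s\<close> is \<open>W i j s\<close>.\<close>

definition extension_bracket ::
    "nat \<Rightarrow> (nat \<Rightarrow> nat \<Rightarrow> nat \<Rightarrow> 'k) \<Rightarrow> ('k, 'g) module \<Rightarrow> ('g \<Rightarrow> 'g \<Rightarrow> 'g)
      \<Rightarrow> (nat \<Rightarrow> 'g) \<Rightarrow> (nat \<Rightarrow> 'g) \<Rightarrow> (nat \<Rightarrow> 'g)" where
  "extension_bracket n W G br x y =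
    (\<lambda>s\<in>{1..n}. \<Oplus>\<^bsub>G\<^esub>i\<in>{1..n}. \<Oplus>\<^bsub>G\<^esub>j\<in>{1..n}. W i j s \<odot>\<^bsub>G\<^esub> br (x i) (y j))"

text \<open>
  HOL cannot quantify over types inside a formula, so the type of the elements of the
  Lie algebras \<open>G\<close> is a parameter; a theorem about
  \<open>universal_extension_tensor TYPE('g)\<close> with \<open>'g\<close> a free type variable covers all Lie algebras.
\<close>

definition universal_extension_tensor ::
    "'g itself \<Rightarrow> ('k, 'm) ring_scheme \<Rightarrow> nat \<Rightarrow> (nat \<Rightarrow> nat \<Rightarrow> nat \<Rightarrow> 'k) \<Rightarrow> bool" where
  "universal_extension_tensor _ K n W \<longleftrightarrow>
    (\<forall>i\<in>{1..n}. \<forall>j\<in>{1..n}. \<forall>s\<in>{1..n}. W i j s \<in> carrier K) \<and>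
    (\<forall>(G :: ('k, 'g) module) br. lie_algebra K G br \<longrightarrow>
      lie_algebra K (tuple_space n G) (extension_bracket n W G br))"

definition E_function :: "nat \<Rightarrow> (nat \<Rightarrow> nat \<Rightarrow> nat) \<Rightarrow> bool" where
  "E_function n f \<longleftrightarrow>
    (\<forall>i\<in>{1..n}. \<forall>j\<in>{1..n}. f i j \<in> {1..n}) \<and>
    (\<forall>i\<in>{1..n}. \<forall>j\<in>{1..n}. f i j = f j i) \<and>
    (\<forall>i\<in>{1..n}. \<forall>j\<in>{1..n}. \<forall>k\<in>{1..n}. f i (f j k) = f (f i j) k)"

definition kronecker_delta :: "('k, 'm) ring_scheme \<Rightarrow> nat \<Rightarrow> nat \<Rightarrow> 'k" where
  "kronecker_delta K a b = (if a = b then \<one>\<^bsub>K\<^esub> else \<zero>\<^bsub>K\<^esub>)"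

end

theory Submission
  imports Defs
begin

text \<open>
  The bracket on tuples is the one of \<open>G\<close> tensored with the monoid algebra of \<open>f\<close>, which is
  commutative and associative.  Component \<open>s\<close> of \<open>[x, [y, z]]\<close> is the sum of
  \<open>[x\<^sub>i, [y\<^sub>j, z\<^sub>k]]\<close> over all \<open>i, j, k\<close> with \<open>i * (j * k) = s\<close>.  This condition is invariant
  under cyclic rotation of \<open>i, j, k\<close>, so the Jacobi identity holds term by term; likewise
  \<open>[x, x]\<close> vanishes because the terms \<open>(i, j)\<close> and \<open>(j, i)\<close> cancel and the diagonal terms
  are zero.
\<close>

section \<open>Iterated finite sums in commutative monoids and abelian groups\<close>

lemma (in abelian_monoid) finsum_swap:
  assumes "finite A" "finite B" "\<And>i j. i \<in> A \<Longrightarrow> j \<in> B \<Longrightarrow> g i j \<in> carrier G"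
  shows "(\<Oplus>i\<in>A. \<Oplus>j\<in>B. g i j) = (\<Oplus>j\<in>B. \<Oplus>i\<in>A. g i j)"
  using assms(1,3)
proof (induction A)
  case empty
  then show ?case by (simp add: finsum_zero)
next
  case (insert a A)
  have "(\<Oplus>i\<in>insert a A. \<Oplus>j\<in>B. g i j) = (\<Oplus>j\<in>B. g a j) \<oplus> (\<Oplus>i\<in>A. \<Oplus>j\<in>B. g i j)"
    using insert by (intro finsum_insert) (auto intro!: finsum_closed)
  also have "\<dots> = (\<Oplus>j\<in>B. g a j) \<oplus> (\<Oplus>j\<in>B. \<Oplus>i\<in>A. g i j)"
    using insert by simp
  also have "\<dots> = (\<Oplus>j\<in>B. g a j \<oplus> (\<Oplus>i\<in>A. g i j))"
    using insert by (intro finsum_addf[symmetric]) (auto intro!: finsum_closed)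
  also have "\<dots> = (\<Oplus>j\<in>B. \<Oplus>i\<in>insert a A. g i j)"
    using insert by (intro finsum_cong' finsum_insert[symmetric]) (auto intro!: finsum_closed)
  finally show ?case .
qed

text \<open>Antisymmetry of \<open>g\<close> alone would not suffice: in characteristic 2 the diagonal survives.\<close>

lemma (in abelian_monoid) finsum_alternating:
  assumes "finite A" "\<And>i j. i \<in> A \<Longrightarrow> j \<in> A \<Longrightarrow> g i j \<in> carrier G"
    and "\<And>i. i \<in> A \<Longrightarrow> g i i = \<zero>"
    and "\<And>i j. i \<in> A \<Longrightarrow> j \<in> A \<Longrightarrow> g i j \<oplus> g j i = \<zero>"
  shows "(\<Oplus>i\<in>A. \<Oplus>j\<in>A. g i j) = \<zero>"
  using assms
proof (induction A)
  case empty
  then show ?case by simp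
next
  case (insert a A)
  have c: "g i j \<in> carrier G" if "i \<in> insert a A" "j \<in> insert a A" for i j
    using insert.prems(1) that by blast
  have row: "(\<Oplus>j\<in>insert a A. g i j) = g i a \<oplus> (\<Oplus>j\<in>A. g i j)" if "i \<in> insert a A" for i
    using insert.hyps that c by (intro finsum_insert) auto
  \<comment> \<open>Split the square into the new row, the new column and the old square. The old
    square sums to zero by induction, the corner \<open>g a a\<close> vanishes, and the rest of the
    row cancels against the rest of the column entry by entry.\<close>
  have "(\<Oplus>i\<in>insert a A. \<Oplus>j\<in>insert a A. g i j)
      = (\<Oplus>j\<in>insert a A. g a j) \<oplus> (\<Oplus>i\<in>A. \<Oplus>j\<in>insert a A. g i j)"
    using insert.hyps c by (intro finsum_insert) (auto intro!: finsum_closed)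
  also have "(\<Oplus>i\<in>A. \<Oplus>j\<in>insert a A. g i j) = (\<Oplus>i\<in>A. g i a \<oplus> (\<Oplus>j\<in>A. g i j))"
    using row c by (intro finsum_cong') (auto intro!: finsum_closed)
  also have "\<dots> = (\<Oplus>i\<in>A. g i a) \<oplus> (\<Oplus>i\<in>A. \<Oplus>j\<in>A. g i j)"
    using c by (intro finsum_addf) (auto intro!: finsum_closed)
  also have "(\<Oplus>i\<in>A. \<Oplus>j\<in>A. g i j) = \<zero>"
    using insert.prems by (intro insert.IH) auto
  also have "(\<Oplus>j\<in>insert a A. g a j) = (\<Oplus>j\<in>A. g a j)"
    using row[of a] insert.prems(2) c by (auto intro!: finsum_closed)
  also have "(\<Oplus>j\<in>A. g a j) \<oplus> ((\<Oplus>i\<in>A. g i a) \<oplus> \<zero>) = (\<Oplus>j\<in>A. g a j) \<oplus> (\<Oplus>i\<in>A. g i a)"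
    using c by (subst r_zero) (auto intro!: finsum_closed)
  also have "\<dots> = (\<Oplus>i\<in>A. g a i \<oplus> g i a)"
    using c by (intro finsum_addf[symmetric]) auto
  also have "\<dots> = (\<Oplus>i\<in>A. \<zero>)"
    using insert.prems(3) by (intro finsum_cong') auto
  finally show ?case by (simp add: finsum_zero)
qed

lemma (in abelian_group) additive_finsum:
  assumes closed: "\<And>x. x \<in> carrier G \<Longrightarrow> h x \<in> carrier G"
    and add: "\<And>x y. x \<in> carrier G \<Longrightarrow> y \<in> carrier G \<Longrightarrow> h (x \<oplus> y) = h x \<oplus> h y"
    and "finite A" "\<And>i. i \<in> A \<Longrightarrow> g i \<in> carrier G"
  shows "h (\<Oplus>i\<in>A. g i) = (\<Oplus>i\<in>A. h (g i))"
  using assms(3,4)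
proof (induction A)
  case empty
  \<comment> \<open>That \<open>h\<close> preserves zero is not assumed: it follows from additivity
    by cancellation, for which a group is used rather than a monoid.\<close>
  have "h \<zero> \<oplus> h \<zero> = h \<zero>"
    using add[of \<zero> \<zero>] by simp
  then show ?case
    using closed[of \<zero>] by simp
next
  case (insert a A)
  have "h (\<Oplus>i\<in>insert a A. g i) = h (g a \<oplus> (\<Oplus>i\<in>A. g i))"
    using insert by (subst finsum_insert) auto
  also have "\<dots> = h (g a) \<oplus> (\<Oplus>i\<in>A. h (g i))"
    using insert by (subst add) (auto intro!: finsum_closed)
  also have "\<dots> = (\<Oplus>i\<in>insert a A. h (g i))"
    using insert closed by (intro finsum_insert[symmetric]) auto
  finally show ?case .
qed

section \<open>Elementary consequences of the Lie algebra axioms\<close>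

context lie_algebra
begin

lemma bracket_zero_right: "x \<in> carrier V \<Longrightarrow> bracket x \<zero>\<^bsub>V\<^esub> = \<zero>\<^bsub>V\<^esub>"
  using bracket_smult_right[of \<zero> x "\<zero>\<^bsub>V\<^esub>"] by (simp add: bracket_closed)

text \<open>Polarization of \<open>bracket_self\<close>: expand the bracket of \<open>x + y\<close>
  with itself by bilinearity.\<close>

lemma bracket_antisym:
  assumes "x \<in> carrier V" "y \<in> carrier V"
  shows "bracket x y \<oplus>\<^bsub>V\<^esub> bracket y x = \<zero>\<^bsub>V\<^esub>"
proof -
  have "\<zero>\<^bsub>V\<^esub> = bracket (x \<oplus>\<^bsub>V\<^esub> y) (x \<oplus>\<^bsub>V\<^esub> y)"
    using assms by (simp add: bracket_self)
  also have "\<dots> = (bracket x x \<oplus>\<^bsub>V\<^esub> bracket y x) \<oplus>\<^bsub>V\<^esub> (bracket x y \<oplus>\<^bsub>V\<^esub> bracket y y)"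
    using assms by (simp add: bracket_add_left bracket_add_right)
  also have "\<dots> = bracket x y \<oplus>\<^bsub>V\<^esub> bracket y x"
    using assms by (simp add: bracket_self bracket_closed M.a_comm)
  finally show ?thesis by simp
qed

lemma bracket_finsum_right:
  assumes "finite A" "x \<in> carrier V" "\<And>i. i \<in> A \<Longrightarrow> g i \<in> carrier V"
  shows "bracket x (\<Oplus>\<^bsub>V\<^esub>i\<in>A. g i) = (\<Oplus>\<^bsub>V\<^esub>i\<in>A. bracket x (g i))"
  using assms by (intro M.additive_finsum) (auto simp: bracket_closed bracket_add_right)

end

section \<open>The vector space of tuples, with componentwise operations\<close>

lemma module_tuple_space:
  assumes "module K G"
  shows "module K (tuple_space n G)"
proof -
  interpret module K G by fact
  show ?thesis
  proof (rule moduleI)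
    show "cring K" ..
    show "abelian_group (tuple_space n G)"
    proof (rule abelian_groupI)
      fix x assume "x \<in> carrier (tuple_space n G)"
      then show "\<exists>y\<in>carrier (tuple_space n G). y \<oplus>\<^bsub>tuple_space n G\<^esub> x = \<zero>\<^bsub>tuple_space n G\<^esub>"
        by (intro bexI[of _ "\<lambda>s\<in>{1..n}. \<ominus>\<^bsub>G\<^esub> x s"])
          (auto simp: tuple_space_def PiE_iff M.l_neg fun_eq_iff)
    next
      fix x y assume "x \<in> carrier (tuple_space n G)" "y \<in> carrier (tuple_space n G)"
      then show "x \<oplus>\<^bsub>tuple_space n G\<^esub> y = y \<oplus>\<^bsub>tuple_space n G\<^esub> x"
        by (auto simp: tuple_space_def PiE_iff fun_eq_iff intro: M.a_comm)
    qed (auto simp: tuple_space_def PiE_iff M.a_assoc fun_eq_iff extensional_def)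
  qed (auto simp: tuple_space_def PiE_iff smult_l_distr smult_r_distr smult_assoc1
        fun_eq_iff extensional_def)
qed

section \<open>The bracket on tuples attached to one Lie algebra and one E-function\<close>

locale lie_algebra_E_function = lie_algebra K V bracket
  for K (structure) and V :: "('a, 'c) module" (structure) and bracket +
  fixes n :: nat and f :: "nat \<Rightarrow> nat \<Rightarrow> nat"
  assumes E_function: "E_function n f"
begin

lemma f_closed: "i \<in> {1..n} \<Longrightarrow> j \<in> {1..n} \<Longrightarrow> f i j \<in> {1..n}"
  and f_commute: "i \<in> {1..n} \<Longrightarrow> j \<in> {1..n} \<Longrightarrow> f i j = f j i"
  and f_assoc: "i \<in> {1..n} \<Longrightarrow> j \<in> {1..n} \<Longrightarrow> k \<in> {1..n} \<Longrightarrow> f i (f j k) = f (f i j) k"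
  using E_function unfolding E_function_def by blast+

abbreviation tuples :: "(nat \<Rightarrow> 'c) set" where
  "tuples \<equiv> {1..n} \<rightarrow>\<^sub>E carrier V"

abbreviation tuple_bracket :: "(nat \<Rightarrow> 'c) \<Rightarrow> (nat \<Rightarrow> 'c) \<Rightarrow> nat \<Rightarrow> 'c" where
  "tuple_bracket \<equiv> extension_bracket n (\<lambda>i j k. kronecker_delta K (f i j) k) V bracket"

text \<open>The coefficient one leaves a bracket unchanged and the coefficient zero kills it. This
  scalar-free form is the one that the computations below start from.\<close>

lemma tuple_bracket_apply:
  assumes "x \<in> tuples" "y \<in> tuples" "s \<in> {1..n}"
  shows "tuple_bracket x y s =
    (\<Oplus>\<^bsub>V\<^esub>i\<in>{1..n}. \<Oplus>\<^bsub>V\<^esub>j\<in>{1..n}. if f i j = s then bracket (x i) (y j) else \<zero>\<^bsub>V\<^esub>)"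
  using assms unfolding extension_bracket_def
  by (auto simp: kronecker_delta_def PiE_iff bracket_closed
      intro!: M.finsum_cong' M.finsum_closed)

lemma tuple_bracket_closed:
  assumes "x \<in> tuples" "y \<in> tuples"
  shows "tuple_bracket x y \<in> tuples"
  using assms unfolding extension_bracket_def
  by (auto simp: kronecker_delta_def PiE_iff bracket_closed intro!: M.finsum_closed)

lemma tuple_bracket_self:
  assumes "x \<in> tuples" "s \<in> {1..n}"
  shows "tuple_bracket x x s = \<zero>\<^bsub>V\<^esub>"
  unfolding tuple_bracket_apply[OF assms(1,1,2)]
proof (rule M.finsum_alternating)
  \<comment> \<open>By commutativity of \<open>f\<close> the two conditions agree, so either both
    terms are zero or they cancel by antisymmetry in \<open>V\<close>.\<close>
  fix i j assume "i \<in> {1..n}" "j \<in> {1..n}"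
  then show "(if f i j = s then bracket (x i) (x j) else \<zero>\<^bsub>V\<^esub>) \<oplus>\<^bsub>V\<^esub>
      (if f j i = s then bracket (x j) (x i) else \<zero>\<^bsub>V\<^esub>) = \<zero>\<^bsub>V\<^esub>"
    using assms E_function by (auto simp: E_function_def PiE_iff bracket_antisym)
qed (use assms in \<open>auto simp: PiE_iff bracket_self bracket_closed\<close>)

section \<open>The Jacobi identity for tuples\<close>

text \<open>The zero default for triples whose product is not \<open>s\<close> lets every sum run
  over the full box of indices, so the order of summation can be changed freely.\<close>

definition triple_term :: "nat \<Rightarrow> (nat \<Rightarrow> 'c) \<Rightarrow> (nat \<Rightarrow> 'c) \<Rightarrow> (nat \<Rightarrow> 'c) \<Rightarrow> nat \<Rightarrow> nat \<Rightarrow> nat \<Rightarrow> 'c" where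
  "triple_term s x y z i j k =
    (if f i (f j k) = s then bracket (x i) (bracket (y j) (z k)) else \<zero>\<^bsub>V\<^esub>)"

lemma triple_term_closed:
  assumes "x \<in> tuples" "y \<in> tuples" "z \<in> tuples" "i \<in> {1..n}" "j \<in> {1..n}" "k \<in> {1..n}"
  shows "triple_term s x y z i j k \<in> carrier V"
  using assms by (auto simp: triple_term_def PiE_iff bracket_closed)

text \<open>Expanding both brackets gives a fourth index \<open>t\<close>, the component of the
  inner bracket. Each pair \<open>j\<close>, \<open>k\<close> contributes to exactly one component,
  namely \<open>t = f j k\<close>, so the sum over \<open>t\<close> collapses and the condition
  \<open>f i t = s\<close> becomes \<open>f i (f j k) = s\<close>.\<close>

lemma tuple_bracket_bracket:
  assumes xyz: "x \<in> tuples" "y \<in> tuples" "z \<in> tuples" and s: "s \<in> {1..n}"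
  shows "tuple_bracket x (tuple_bracket y z) s =
    (\<Oplus>\<^bsub>V\<^esub>i\<in>{1..n}. \<Oplus>\<^bsub>V\<^esub>j\<in>{1..n}. \<Oplus>\<^bsub>V\<^esub>k\<in>{1..n}. triple_term s x y z i j k)"
proof -
  \<comment> \<open>The uncollapsed summand: it can be nonzero only if \<open>f j k = t\<close> and
    \<open>f i t = s\<close>.\<close>
  define c where "c i t j k = (if f j k = t then triple_term s x y z i j k else \<zero>\<^bsub>V\<^esub>)" for i t j k
  have c: "c i t j k \<in> carrier V"
    if "i \<in> {1..n}" "t \<in> {1..n}" "j \<in> {1..n}" "k \<in> {1..n}" for i t j k
    using that triple_term_closed[OF xyz] by (simp add: c_def)
  have inner: "(if f i t = s then bracket (x i) (tuple_bracket y z t) else \<zero>\<^bsub>V\<^esub>) =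
      (\<Oplus>\<^bsub>V\<^esub>j\<in>{1..n}. \<Oplus>\<^bsub>V\<^esub>k\<in>{1..n}. c i t j k)" if i: "i \<in> {1..n}" and t: "t \<in> {1..n}" for i t
  \<comment> \<open>If the outer condition holds, \<open>bracket (x i)\<close> is moved inside both
    sums of the inner bracket; otherwise every \<open>c i t j k\<close> is zero.\<close>
  proof (cases "f i t = s")
    case True
    have xi: "x i \<in> carrier V"
      using xyz i by auto
    define b where "b j k = (if f j k = t then bracket (y j) (z k) else \<zero>\<^bsub>V\<^esub>)" for j k
    have b: "b j k \<in> carrier V" if "j \<in> {1..n}" "k \<in> {1..n}" for j k
      using that xyz by (auto simp: b_def PiE_iff bracket_closed)
    have bc: "bracket (x i) (b j k) = c i t j k" for j k
      using True xi by (auto simp: b_def c_def triple_term_def bracket_zero_right)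
    have "bracket (x i) (tuple_bracket y z t) =
        bracket (x i) (\<Oplus>\<^bsub>V\<^esub>j\<in>{1..n}. \<Oplus>\<^bsub>V\<^esub>k\<in>{1..n}. b j k)"
      unfolding tuple_bracket_apply[OF xyz(2,3) t] b_def ..
    also have "\<dots> = (\<Oplus>\<^bsub>V\<^esub>j\<in>{1..n}. bracket (x i) (\<Oplus>\<^bsub>V\<^esub>k\<in>{1..n}. b j k))"
      using xi b by (intro bracket_finsum_right) (auto intro!: M.finsum_closed)
    also have "\<dots> = (\<Oplus>\<^bsub>V\<^esub>j\<in>{1..n}. \<Oplus>\<^bsub>V\<^esub>k\<in>{1..n}. bracket (x i) (b j k))"
      using xi b by (intro M.finsum_cong' bracket_finsum_right)
        (auto intro!: M.finsum_closed bracket_closed)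
    finally show ?thesis
      using True by (simp add: bc)
  next
    case False
    have z: "c i t j k = \<zero>\<^bsub>V\<^esub>" for j k
      using False by (auto simp: c_def triple_term_def)
    show ?thesis
      using False by (simp add: z M.finsum_zero)
  qed
  \<comment> \<open>Only \<open>t = f j k\<close> contributes, and this index lies in the range of
    summation because \<open>f\<close> maps into \<open>{1..n}\<close>.\<close>
  have collapse: "(\<Oplus>\<^bsub>V\<^esub>t\<in>{1..n}. c i t j k) = triple_term s x y z i j k"
    if "i \<in> {1..n}" "j \<in> {1..n}" "k \<in> {1..n}" for i j k
    unfolding c_def using that E_function triple_term_closed[OF xyz]
    by (intro M.finsum_singleton) (auto simp: E_function_def simp del: One_nat_def)
  \<comment> \<open>Two interchanges carry \<open>t\<close> inwards past \<open>j\<close> and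
    \<open>k\<close>, where \<open>collapse\<close> removes it.\<close>
  have rearrange: "(\<Oplus>\<^bsub>V\<^esub>t\<in>{1..n}. \<Oplus>\<^bsub>V\<^esub>j\<in>{1..n}. \<Oplus>\<^bsub>V\<^esub>k\<in>{1..n}. c i t j k) =
      (\<Oplus>\<^bsub>V\<^esub>j\<in>{1..n}. \<Oplus>\<^bsub>V\<^esub>k\<in>{1..n}. triple_term s x y z i j k)" if i: "i \<in> {1..n}" for i
  proof -
    have "(\<Oplus>\<^bsub>V\<^esub>t\<in>{1..n}. \<Oplus>\<^bsub>V\<^esub>j\<in>{1..n}. \<Oplus>\<^bsub>V\<^esub>k\<in>{1..n}. c i t j k) =
        (\<Oplus>\<^bsub>V\<^esub>j\<in>{1..n}. \<Oplus>\<^bsub>V\<^esub>t\<in>{1..n}. \<Oplus>\<^bsub>V\<^esub>k\<in>{1..n}. c i t j k)"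
      using i c by (intro M.finsum_swap) (auto intro!: M.finsum_closed)
    also have "\<dots> = (\<Oplus>\<^bsub>V\<^esub>j\<in>{1..n}. \<Oplus>\<^bsub>V\<^esub>k\<in>{1..n}. \<Oplus>\<^bsub>V\<^esub>t\<in>{1..n}. c i t j k)"
      using i c by (intro M.finsum_cong' M.finsum_swap) (auto intro!: M.finsum_closed)
    also have "\<dots> = (\<Oplus>\<^bsub>V\<^esub>j\<in>{1..n}. \<Oplus>\<^bsub>V\<^esub>k\<in>{1..n}. triple_term s x y z i j k)"
      using collapse i triple_term_closed[OF xyz]
      by (intro M.finsum_cong') (auto intro!: M.finsum_closed simp del: One_nat_def)
    finally show ?thesis .
  qed
  have "tuple_bracket x (tuple_bracket y z) s =
      (\<Oplus>\<^bsub>V\<^esub>i\<in>{1..n}. \<Oplus>\<^bsub>V\<^esub>t\<in>{1..n}. \<Oplus>\<^bsub>V\<^esub>j\<in>{1..n}. \<Oplus>\<^bsub>V\<^esub>k\<in>{1..n}. c i t j k)"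
    unfolding tuple_bracket_apply[OF xyz(1) tuple_bracket_closed[OF xyz(2,3)] s]
    using inner c by (intro M.finsum_cong') (auto intro!: M.finsum_closed)
  also have "\<dots> = (\<Oplus>\<^bsub>V\<^esub>i\<in>{1..n}. \<Oplus>\<^bsub>V\<^esub>j\<in>{1..n}. \<Oplus>\<^bsub>V\<^esub>k\<in>{1..n}. triple_term s x y z i j k)"
    using triple_term_closed[OF xyz]
    by (intro M.finsum_cong'[OF refl _ rearrange]) (auto intro!: M.finsum_closed)
  finally show ?thesis .
qed

text \<open>Two interchanges bring the innermost index to the front. This aligns the three double
  brackets of the Jacobi identity, whose expansions are nested in cyclically rotated orders.\<close>

lemma triple_sum_rotate:
  assumes "\<And>i j k. i \<in> {1..n} \<Longrightarrow> j \<in> {1..n} \<Longrightarrow> k \<in> {1..n} \<Longrightarrow> g i j k \<in> carrier V"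
  shows "(\<Oplus>\<^bsub>V\<^esub>i\<in>{1..n}. \<Oplus>\<^bsub>V\<^esub>j\<in>{1..n}. \<Oplus>\<^bsub>V\<^esub>k\<in>{1..n}. g i j k) =
    (\<Oplus>\<^bsub>V\<^esub>k\<in>{1..n}. \<Oplus>\<^bsub>V\<^esub>i\<in>{1..n}. \<Oplus>\<^bsub>V\<^esub>j\<in>{1..n}. g i j k)"
proof -
  have "(\<Oplus>\<^bsub>V\<^esub>i\<in>{1..n}. \<Oplus>\<^bsub>V\<^esub>j\<in>{1..n}. \<Oplus>\<^bsub>V\<^esub>k\<in>{1..n}. g i j k) =
      (\<Oplus>\<^bsub>V\<^esub>i\<in>{1..n}. \<Oplus>\<^bsub>V\<^esub>k\<in>{1..n}. \<Oplus>\<^bsub>V\<^esub>j\<in>{1..n}. g i j k)"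
    using assms by (intro M.finsum_cong' M.finsum_swap) (auto intro!: M.finsum_closed)
  also have "\<dots> = (\<Oplus>\<^bsub>V\<^esub>k\<in>{1..n}. \<Oplus>\<^bsub>V\<^esub>i\<in>{1..n}. \<Oplus>\<^bsub>V\<^esub>j\<in>{1..n}. g i j k)"
    using assms by (intro M.finsum_swap) (auto intro!: M.finsum_closed)
  finally show ?thesis .
qed

text \<open>The three products of indices coincide, so the terms are either all zero or exactly
  those of the Jacobi identity in \<open>V\<close>.\<close>

lemma triple_term_jacobi:
  assumes "x \<in> tuples" "y \<in> tuples" "z \<in> tuples" "i \<in> {1..n}" "j \<in> {1..n}" "k \<in> {1..n}"
  shows "triple_term s x y z i j k \<oplus>\<^bsub>V\<^esub> triple_term s y z x j k i \<oplus>\<^bsub>V\<^esub> triple_term s z x y k i j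
    = \<zero>\<^bsub>V\<^esub>"
proof -
  \<comment> \<open>Reassociate to \<open>f (f j k) i\<close> and \<open>f (f i j) k\<close>.
    Commuting the outer factors settles the first; for the second, associativity is applied once
    more. Closure of \<open>f\<close> makes the inner products admissible arguments.\<close>
  have "f j (f k i) = f i (f j k)" "f k (f i j) = f i (f j k)"
    using f_assoc[of j k i] f_assoc[of i j k] f_commute[of "f j k" i] f_commute[of k "f i j"]
      f_closed[of j k] f_closed[of i j] assms(4-6) by metis+
  moreover have "x i \<in> carrier V" "y j \<in> carrier V" "z k \<in> carrier V"
    using assms by auto
  ultimately show ?thesis
    by (simp add: triple_term_def bracket_jacobi)
qed

lemma tuple_bracket_jacobi:
  assumes x: "x \<in> tuples" and y: "y \<in> tuples" and z: "z \<in> tuples" and s: "s \<in> {1..n}"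
  shows "tuple_bracket x (tuple_bracket y z) s \<oplus>\<^bsub>V\<^esub> tuple_bracket y (tuple_bracket z x) s
    \<oplus>\<^bsub>V\<^esub> tuple_bracket z (tuple_bracket x y) s = \<zero>\<^bsub>V\<^esub>"
proof -
  \<comment> \<open>In all three families \<open>i\<close>, \<open>j\<close>, \<open>k\<close> index
    the components of \<open>x\<close>, \<open>y\<close>, \<open>z\<close> respectively, whatever
    the order of the brackets.\<close>
  let ?a = "\<lambda>i j k. triple_term s x y z i j k"
  let ?b = "\<lambda>i j k. triple_term s y z x j k i"
  let ?c = "\<lambda>i j k. triple_term s z x y k i j"
  let ?S = "\<lambda>g. \<Oplus>\<^bsub>V\<^esub>i\<in>{1..n}. \<Oplus>\<^bsub>V\<^esub>j\<in>{1..n}. \<Oplus>\<^bsub>V\<^esub>k\<in>{1..n}. g i j k"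
  note cl = triple_term_closed[OF x y z] triple_term_closed[OF y z x] triple_term_closed[OF z x y]
  have add: "?S g \<oplus>\<^bsub>V\<^esub> ?S h = ?S (\<lambda>i j k. g i j k \<oplus>\<^bsub>V\<^esub> h i j k)"
    if g: "\<And>i j k. i \<in> {1..n} \<Longrightarrow> j \<in> {1..n} \<Longrightarrow> k \<in> {1..n} \<Longrightarrow> g i j k \<in> carrier V"
      and h: "\<And>i j k. i \<in> {1..n} \<Longrightarrow> j \<in> {1..n} \<Longrightarrow> k \<in> {1..n} \<Longrightarrow> h i j k \<in> carrier V" for g h
  proof -
    have "?S (\<lambda>i j k. g i j k \<oplus>\<^bsub>V\<^esub> h i j k) = (\<Oplus>\<^bsub>V\<^esub>i\<in>{1..n}. \<Oplus>\<^bsub>V\<^esub>j\<in>{1..n}.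
        (\<Oplus>\<^bsub>V\<^esub>k\<in>{1..n}. g i j k) \<oplus>\<^bsub>V\<^esub> (\<Oplus>\<^bsub>V\<^esub>k\<in>{1..n}. h i j k))"
      using g h by (intro M.finsum_cong' M.finsum_addf) (auto intro!: M.finsum_closed)
    also have "\<dots> = (\<Oplus>\<^bsub>V\<^esub>i\<in>{1..n}. (\<Oplus>\<^bsub>V\<^esub>j\<in>{1..n}. \<Oplus>\<^bsub>V\<^esub>k\<in>{1..n}. g i j k) \<oplus>\<^bsub>V\<^esub>
        (\<Oplus>\<^bsub>V\<^esub>j\<in>{1..n}. \<Oplus>\<^bsub>V\<^esub>k\<in>{1..n}. h i j k))"
      using g h by (intro M.finsum_cong' M.finsum_addf) (auto intro!: M.finsum_closed)
    also have "\<dots> = ?S g \<oplus>\<^bsub>V\<^esub> ?S h"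
      using g h by (intro M.finsum_addf) (auto intro!: M.finsum_closed)
    finally show ?thesis by simp
  qed
  \<comment> \<open>The expansion of the second double bracket is nested in the order
    \<open>j\<close>, \<open>k\<close>, \<open>i\<close> and needs one rotation; the third is nested
    in the order \<open>k\<close>, \<open>i\<close>, \<open>j\<close> and needs the inverse
    rotation.\<close>
  have b: "tuple_bracket y (tuple_bracket z x) s = ?S ?b"
    unfolding tuple_bracket_bracket[OF y z x s] using cl by (intro triple_sum_rotate) auto
  have c: "tuple_bracket z (tuple_bracket x y) s = ?S ?c"
    unfolding tuple_bracket_bracket[OF z x y s]
    using cl by (intro triple_sum_rotate[symmetric]) auto
  have "?S ?a \<oplus>\<^bsub>V\<^esub> ?S ?b \<oplus>\<^bsub>V\<^esub> ?S ?c = ?S (\<lambda>i j k. ?a i j k \<oplus>\<^bsub>V\<^esub> ?b i j k \<oplus>\<^bsub>V\<^esub> ?c i j k)"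
    using cl by (subst add, simp, simp, subst add) auto
  also have "\<dots> = ?S (\<lambda>i j k. \<zero>\<^bsub>V\<^esub>)"
    by (intro M.finsum_cong' triple_term_jacobi[OF x y z]) (auto intro!: M.finsum_closed)
  finally show ?thesis
    by (simp add: b c tuple_bracket_bracket[OF x y z s] M.finsum_zero)
qed

section \<open>Bilinearity of the bracket on tuples\<close>

lemma tuple_bracket_add_left:
  assumes "x \<in> tuples" "y \<in> tuples" "z \<in> tuples" "s \<in> {1..n}"
  shows "tuple_bracket (\<lambda>t\<in>{1..n}. x t \<oplus>\<^bsub>V\<^esub> y t) z s =
    tuple_bracket x z s \<oplus>\<^bsub>V\<^esub> tuple_bracket y z s"
proof -
  let ?t = "\<lambda>x i j. if f i j = s then bracket (x i) (z j) else \<zero>\<^bsub>V\<^esub>"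
  have cl: "?t x i j \<in> carrier V" "?t y i j \<in> carrier V" if "i \<in> {1..n}" "j \<in> {1..n}" for i j
    using that assms by (auto simp: PiE_iff bracket_closed)
  have xy: "(\<lambda>t\<in>{1..n}. x t \<oplus>\<^bsub>V\<^esub> y t) \<in> tuples"
    using assms by (auto simp: PiE_iff)
  have "tuple_bracket (\<lambda>t\<in>{1..n}. x t \<oplus>\<^bsub>V\<^esub> y t) z s =
      (\<Oplus>\<^bsub>V\<^esub>i\<in>{1..n}. \<Oplus>\<^bsub>V\<^esub>j\<in>{1..n}. ?t x i j \<oplus>\<^bsub>V\<^esub> ?t y i j)"
    unfolding tuple_bracket_apply[OF xy assms(3,4)]
    using assms cl by (intro M.finsum_cong')
      (auto simp: PiE_iff bracket_add_left bracket_closed intro!: M.finsum_closed)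
  also have "\<dots> = (\<Oplus>\<^bsub>V\<^esub>i\<in>{1..n}. (\<Oplus>\<^bsub>V\<^esub>j\<in>{1..n}. ?t x i j) \<oplus>\<^bsub>V\<^esub> (\<Oplus>\<^bsub>V\<^esub>j\<in>{1..n}. ?t y i j))"
    using cl by (intro M.finsum_cong' M.finsum_addf) (auto intro!: M.finsum_closed)
  also have "\<dots> = tuple_bracket x z s \<oplus>\<^bsub>V\<^esub> tuple_bracket y z s"
    unfolding tuple_bracket_apply[OF assms(1,3,4)] tuple_bracket_apply[OF assms(2,3,4)]
    using cl by (intro M.finsum_addf) (auto intro!: M.finsum_closed)
  finally show ?thesis .
qed

lemma tuple_bracket_smult_left:
  assumes "a \<in> carrier K" "x \<in> tuples" "z \<in> tuples" "s \<in> {1..n}"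
  shows "tuple_bracket (\<lambda>t\<in>{1..n}. a \<odot>\<^bsub>V\<^esub> x t) z s = a \<odot>\<^bsub>V\<^esub> tuple_bracket x z s"
proof -
  let ?t = "\<lambda>i j. if f i j = s then bracket (x i) (z j) else \<zero>\<^bsub>V\<^esub>"
  have cl: "?t i j \<in> carrier V" if "i \<in> {1..n}" "j \<in> {1..n}" for i j
    using that assms by (auto simp: PiE_iff bracket_closed)
  have ax: "(\<lambda>t\<in>{1..n}. a \<odot>\<^bsub>V\<^esub> x t) \<in> tuples"
    using assms by (auto simp: PiE_iff)
  have "tuple_bracket (\<lambda>t\<in>{1..n}. a \<odot>\<^bsub>V\<^esub> x t) z s =
      (\<Oplus>\<^bsub>V\<^esub>i\<in>{1..n}. \<Oplus>\<^bsub>V\<^esub>j\<in>{1..n}. a \<odot>\<^bsub>V\<^esub> ?t i j)"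
    unfolding tuple_bracket_apply[OF ax assms(3,4)]
    using assms cl by (intro M.finsum_cong')
      (auto simp: PiE_iff bracket_smult_left bracket_closed intro!: M.finsum_closed)
  also have "\<dots> = (\<Oplus>\<^bsub>V\<^esub>i\<in>{1..n}. a \<odot>\<^bsub>V\<^esub> (\<Oplus>\<^bsub>V\<^esub>j\<in>{1..n}. ?t i j))"
    using cl assms(1) by (intro M.finsum_cong' finsum_smult_ldistr[symmetric])
      (auto intro!: M.finsum_closed)
  also have "\<dots> = a \<odot>\<^bsub>V\<^esub> tuple_bracket x z s"
    unfolding tuple_bracket_apply[OF assms(2,3,4)]
    using cl assms(1) by (intro finsum_smult_ldistr[symmetric]) (auto intro!: M.finsum_closed)
  finally show ?thesis .
qed

text \<open>Carries linearity from the left argument to the right one. Polarizing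
  \<open>tuple_bracket_self\<close> would require additivity on the right, which is itself deduced
  from this lemma, so the cancellation is done term by term.\<close>

lemma tuple_bracket_antisym:
  assumes "x \<in> tuples" "y \<in> tuples" "s \<in> {1..n}"
  shows "tuple_bracket x y s = \<ominus>\<^bsub>V\<^esub> tuple_bracket y x s"
proof -
  let ?t = "\<lambda>x y i j. if f i j = s then bracket (x i) (y j) else \<zero>\<^bsub>V\<^esub>"
  have cl: "?t x y i j \<in> carrier V" "?t y x i j \<in> carrier V"
    if "i \<in> {1..n}" "j \<in> {1..n}" for i j
    using that assms by (auto simp: PiE_iff bracket_closed)
  \<comment> \<open>The bound indices of the second sum are renamed so that, after one interchange,
    the term \<open>(j, i)\<close> of the second bracket meets the term \<open>(i, j)\<close> of the
    first.\<close>
  have "tuple_bracket x y s \<oplus>\<^bsub>V\<^esub> tuple_bracket y x s =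
      (\<Oplus>\<^bsub>V\<^esub>i\<in>{1..n}. \<Oplus>\<^bsub>V\<^esub>j\<in>{1..n}. ?t x y i j) \<oplus>\<^bsub>V\<^esub> (\<Oplus>\<^bsub>V\<^esub>j\<in>{1..n}. \<Oplus>\<^bsub>V\<^esub>i\<in>{1..n}. ?t y x j i)"
    unfolding tuple_bracket_apply[OF assms(1,2,3)] tuple_bracket_apply[OF assms(2,1,3)] ..
  also have "(\<Oplus>\<^bsub>V\<^esub>j\<in>{1..n}. \<Oplus>\<^bsub>V\<^esub>i\<in>{1..n}. ?t y x j i) = (\<Oplus>\<^bsub>V\<^esub>i\<in>{1..n}. \<Oplus>\<^bsub>V\<^esub>j\<in>{1..n}. ?t y x j i)"
    using cl by (intro M.finsum_swap) auto
  also have "(\<Oplus>\<^bsub>V\<^esub>i\<in>{1..n}. \<Oplus>\<^bsub>V\<^esub>j\<in>{1..n}. ?t x y i j) \<oplus>\<^bsub>V\<^esub> \<dots> =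
      (\<Oplus>\<^bsub>V\<^esub>i\<in>{1..n}. (\<Oplus>\<^bsub>V\<^esub>j\<in>{1..n}. ?t x y i j) \<oplus>\<^bsub>V\<^esub> (\<Oplus>\<^bsub>V\<^esub>j\<in>{1..n}. ?t y x j i))"
    using cl by (intro M.finsum_addf[symmetric]) (auto intro!: M.finsum_closed)
  also have "\<dots> = (\<Oplus>\<^bsub>V\<^esub>i\<in>{1..n}. \<Oplus>\<^bsub>V\<^esub>j\<in>{1..n}. ?t x y i j \<oplus>\<^bsub>V\<^esub> ?t y x j i)"
    using cl by (intro M.finsum_cong' M.finsum_addf[symmetric]) (auto intro!: M.finsum_closed)
  also have "\<dots> = (\<Oplus>\<^bsub>V\<^esub>i\<in>{1..n}. \<Oplus>\<^bsub>V\<^esub>j\<in>{1..n}. \<zero>\<^bsub>V\<^esub>)"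
    using assms E_function by (intro M.finsum_cong')
      (auto simp: E_function_def PiE_iff bracket_antisym)
  finally have "tuple_bracket x y s \<oplus>\<^bsub>V\<^esub> tuple_bracket y x s = \<zero>\<^bsub>V\<^esub>"
    by (simp add: M.finsum_zero)
  moreover have "tuple_bracket x y s \<in> carrier V" "tuple_bracket y x s \<in> carrier V"
    using assms tuple_bracket_closed by blast+
  ultimately show ?thesis
    by (simp add: M.minus_equality)
qed

text \<open>Swap the arguments by antisymmetry, add on the left, and distribute the minus sign over
  the sum.\<close>

lemma tuple_bracket_add_right:
  assumes "x \<in> tuples" "y \<in> tuples" "z \<in> tuples" "s \<in> {1..n}"
  shows "tuple_bracket z (\<lambda>t\<in>{1..n}. x t \<oplus>\<^bsub>V\<^esub> y t) s =
    tuple_bracket z x s \<oplus>\<^bsub>V\<^esub> tuple_bracket z y s"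
proof -
  have "(\<lambda>t\<in>{1..n}. x t \<oplus>\<^bsub>V\<^esub> y t) \<in> tuples"
    using assms by (auto simp: PiE_iff)
  moreover have "tuple_bracket x z s \<in> carrier V" "tuple_bracket y z s \<in> carrier V"
    using assms tuple_bracket_closed by blast+
  ultimately show ?thesis
    using assms tuple_bracket_antisym[of z] tuple_bracket_add_left[of x y z s]
    by (simp add: M.minus_add)
qed

lemma tuple_bracket_smult_right:
  assumes "a \<in> carrier K" "x \<in> tuples" "z \<in> tuples" "s \<in> {1..n}"
  shows "tuple_bracket z (\<lambda>t\<in>{1..n}. a \<odot>\<^bsub>V\<^esub> x t) s = a \<odot>\<^bsub>V\<^esub> tuple_bracket z x s"
proof -
  have "(\<lambda>t\<in>{1..n}. a \<odot>\<^bsub>V\<^esub> x t) \<in> tuples"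
    using assms by (auto simp: PiE_iff)
  moreover have "tuple_bracket x z s \<in> carrier V"
    using assms tuple_bracket_closed by blast
  ultimately show ?thesis
    using assms tuple_bracket_antisym[of z] tuple_bracket_smult_left[of a x z s]
    by (simp add: smult_r_minus)
qed

section \<open>Assembling the Lie algebra of tuples, and universality\<close>

lemma lie_algebra_tuple_space:
  "lie_algebra K (tuple_space n V)
    (extension_bracket n (\<lambda>i j k. kronecker_delta K (f i j) k) V bracket)"
proof (intro lie_algebra.intro lie_algebra_axioms.intro)
  have carrier: "carrier (tuple_space n V) = tuples"
    by (simp add: tuple_space_def)
  have zero: "\<zero>\<^bsub>tuple_space n V\<^esub> = (\<lambda>s\<in>{1..n}. \<zero>\<^bsub>V\<^esub>)"
    by (simp add: tuple_space_def)
  have add: "x \<oplus>\<^bsub>tuple_space n V\<^esub> y = (\<lambda>s\<in>{1..n}. x s \<oplus>\<^bsub>V\<^esub> y s)" for x y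
    by (simp add: tuple_space_def)
  have smult: "a \<odot>\<^bsub>tuple_space n V\<^esub> x = (\<lambda>s\<in>{1..n}. a \<odot>\<^bsub>V\<^esub> x s)" for a x
    by (simp add: tuple_space_def)
  \<comment> \<open>Off the index range both sides of each axiom take the default value of
    extensional functions, so equality of tuples reduces to the componentwise lemmas.\<close>
  have outside: "tuple_bracket x y s = undefined" if "s \<notin> {1..n}" for x y s
    using that by (auto simp: extension_bracket_def)
  show "field K" ..
  show "module K (tuple_space n V)"
    by (rule module_tuple_space) (rule module_axioms)
  show "tuple_bracket x y \<in> carrier (tuple_space n V)"
    if "x \<in> carrier (tuple_space n V)" "y \<in> carrier (tuple_space n V)" for x y
    using that tuple_bracket_closed by (simp add: carrier)
  show "tuple_bracket (x \<oplus>\<^bsub>tuple_space n V\<^esub> y) z =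
      tuple_bracket x z \<oplus>\<^bsub>tuple_space n V\<^esub> tuple_bracket y z"
    if "x \<in> carrier (tuple_space n V)" "y \<in> carrier (tuple_space n V)"
      "z \<in> carrier (tuple_space n V)" for x y z
    using that unfolding add carrier
    by (intro ext) (auto simp: tuple_bracket_add_left outside simp del: One_nat_def)
  show "tuple_bracket x (y \<oplus>\<^bsub>tuple_space n V\<^esub> z) =
      tuple_bracket x y \<oplus>\<^bsub>tuple_space n V\<^esub> tuple_bracket x z"
    if "x \<in> carrier (tuple_space n V)" "y \<in> carrier (tuple_space n V)"
      "z \<in> carrier (tuple_space n V)" for x y z
    using that unfolding add carrier
    by (intro ext) (auto simp: tuple_bracket_add_right outside simp del: One_nat_def)
  show "tuple_bracket (a \<odot>\<^bsub>tuple_space n V\<^esub> x) y = a \<odot>\<^bsub>tuple_space n V\<^esub> tuple_bracket x y"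
    if "a \<in> carrier K" "x \<in> carrier (tuple_space n V)" "y \<in> carrier (tuple_space n V)" for a x y
    using that unfolding smult carrier
    by (intro ext) (auto simp: tuple_bracket_smult_left outside simp del: One_nat_def)
  show "tuple_bracket x (a \<odot>\<^bsub>tuple_space n V\<^esub> y) = a \<odot>\<^bsub>tuple_space n V\<^esub> tuple_bracket x y"
    if "a \<in> carrier K" "x \<in> carrier (tuple_space n V)" "y \<in> carrier (tuple_space n V)" for a x y
    using that unfolding smult carrier
    by (intro ext) (auto simp: tuple_bracket_smult_right outside simp del: One_nat_def)
  show "tuple_bracket x x = \<zero>\<^bsub>tuple_space n V\<^esub>" if "x \<in> carrier (tuple_space n V)" for x
    using that unfolding zero carrier
    by (intro ext) (auto simp: tuple_bracket_self outside simp del: One_nat_def)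
  show "tuple_bracket x (tuple_bracket y z) \<oplus>\<^bsub>tuple_space n V\<^esub>
      tuple_bracket y (tuple_bracket z x) \<oplus>\<^bsub>tuple_space n V\<^esub>
      tuple_bracket z (tuple_bracket x y) = \<zero>\<^bsub>tuple_space n V\<^esub>"
    if "x \<in> carrier (tuple_space n V)" "y \<in> carrier (tuple_space n V)"
      "z \<in> carrier (tuple_space n V)" for x y z
    using that unfolding add zero carrier
    by (intro restrict_ext) (simp add: tuple_bracket_jacobi)
qed

end

theorem mainTheorem4:
  fixes K :: "('k, 'm) ring_scheme"
    and n :: nat
    and f :: "nat \<Rightarrow> nat \<Rightarrow> nat"
  assumes "field K"
    and "n \<ge> 1"
    and "E_function n f"
  shows "universal_extension_tensor TYPE('g) K n (\<lambda>i j k. kronecker_delta K (f i j) k)"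
proof -
  \<comment> \<open>Supplies that zero and one lie in \<open>carrier K\<close>, which is the
    membership condition on the coefficients.\<close>
  interpret field K by fact
  have "lie_algebra K (tuple_space n G)
      (extension_bracket n (\<lambda>i j k. kronecker_delta K (f i j) k) G br)"
    if "lie_algebra K G br" for G :: "('k, 'g) module" and br
    using that assms(3)
    by (intro lie_algebra_E_function.lie_algebra_tuple_space
        lie_algebra_E_function.intro lie_algebra_E_function_axioms.intro)
  then show ?thesis
    by (simp add: universal_extension_tensor_def kronecker_delta_def)
qed

end
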